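(* For every Korselt number ($KN$) $n$, $$r\le\frac{\sqrt{8n+1}+1}{4}\qquad\text{and}\qquad r\le\left\lceil\sqrt{\frac n2}\right\rceil,$$ with equality (in each of the two inequalities) if and only if $E=2$.
   Context: A Korselt number ($KN$) is an integer $n$ together with a factorisation $n=\prod_{i=1}^d p_i$, where $d\ge 3$ and $1<p_1<p_2<\dots<p_d$ are odd integers (not necessarily prime), such that $p_i-1$ divides $n-1$ for every $i$, and such that $E:=\dfrac{n/p_d-1}{p_d-1}$ (which is an integer by the divisibility condition) satisfies $E\ge 2$. Notation: $r:=p_d$. *)

theory Defs
  imports Complex_Main
begin

text \<open>
  The quotient is taken in the reals, so no truncation is hidden in it; for Korselt numbers
  its value is an integer, see \<open>korselt_quotient_in_Ints\<close>.
\<close>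

definition korselt_quotient :: "int \<Rightarrow> int \<Rightarrow> real" where
  "korselt_quotient n r = (real_of_int n / real_of_int r - 1) / (real_of_int r - 1)"

text \<open>
  A Korselt number comes together with a factorisation, so the predicate takes the number of
  factors \<open>d\<close> and the factors \<open>p 1 < \<dots> < p d\<close> as arguments; values of \<open>p\<close> outside
  \<open>{1..d}\<close> are irrelevant.
\<close>

definition korselt_number :: "int \<Rightarrow> nat \<Rightarrow> (nat \<Rightarrow> int) \<Rightarrow> bool" where
  "korselt_number n d p \<longleftrightarrow>
     d \<ge> 3 \<and>
     n = (\<Prod>i=1..d. p i) \<and>
     strict_mono_on {1..d} p \<and>
     (\<forall>i\<in>{1..d}. 1 < p i \<and> odd (p i) \<and> (p i - 1) dvd (n - 1)) \<and>
     korselt_quotient n (p d) \<ge> 2"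

lemma korselt_quotient_in_Ints:
  assumes "korselt_number n d p"
  shows "korselt_quotient n (p d) \<in> \<int>"
proof -
  let ?r = "p d"
  have d: "d \<in> {1..d}" and r: "1 < ?r" and dv: "(?r - 1) dvd (n - 1)"
    and n: "n = (\<Prod>i=1..d. p i)"
    using assms by (auto simp: korselt_number_def)
  have "?r dvd n"
    unfolding n using d by (intro dvd_prodI) auto
  then obtain m where m: "n = ?r * m" ..
  have "n - 1 = (?r - 1) * m + (m - 1)"
    by (simp add: m algebra_simps)
  with dv have "(?r - 1) dvd (m - 1)"
    by (metis dvd_add_right_iff dvd_triv_left)
  then obtain e where e: "m - 1 = (?r - 1) * e" ..
  have "real_of_int n / real_of_int ?r - 1 = real_of_int (m - 1)"
    using r by (simp add: m)
  also have "\<dots> = (real_of_int ?r - 1) * real_of_int e"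
    unfolding e by simp
  finally have "korselt_quotient n ?r = real_of_int e"
    using r by (simp add: korselt_quotient_def)
  then show ?thesis by simp
qed

end

theory Submission
  imports Defs
begin

text \<open>
  Solving the definition of \<open>E\<close> for \<open>n\<close> gives \<open>n = r (1 + E (r - 1))\<close>. For \<open>E = 2\<close> this is
  \<open>2 r\<^sup>2 - r\<close>, so \<open>8 n + 1 = (4 r - 1)\<^sup>2\<close> and \<open>(r - 1)\<^sup>2 < n / 2 \<le> r\<^sup>2\<close>. Otherwise
  \<open>E \<ge> 3\<close> by integrality, and then \<open>n / 2 \<ge> r (3 r - 2) / 2 > r\<^sup>2\<close> because \<open>r \<ge> 3\<close>.
\<close>

lemma korselt_number_eq:
  assumes "korselt_quotient n r = E" "r > 1"
  shows "real_of_int n = real_of_int r * (1 + E * (real_of_int r - 1))"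
  using assms by (auto simp: korselt_quotient_def field_simps)

theorem theorem3p7:
  fixes n :: int and d :: nat and p :: "nat \<Rightarrow> int"
  assumes "korselt_number n d p"
  shows "real_of_int (p d) \<le> (sqrt (8 * real_of_int n + 1) + 1) / 4 \<and>
         (real_of_int (p d) = (sqrt (8 * real_of_int n + 1) + 1) / 4
            \<longleftrightarrow> korselt_quotient n (p d) = 2) \<and>
         p d \<le> \<lceil>sqrt (real_of_int n / 2)\<rceil> \<and>
         (p d = \<lceil>sqrt (real_of_int n / 2)\<rceil> \<longleftrightarrow> korselt_quotient n (p d) = 2)"
proof -
  define r where "r = p d"
  define x where "x = real_of_int r"
  define E where "E = korselt_quotient n r"
  have "1 < r" "odd r" "E \<ge> 2"
    using assms by (auto simp: korselt_number_def r_def E_def)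
  then have "r \<ge> 3"
    by (auto elim!: oddE)
  then have x: "x \<ge> 3"
    by (simp add: x_def)
  have n: "real_of_int n = x * (1 + E * (x - 1))"
    unfolding x_def by (rule korselt_number_eq) (use E_def \<open>1 < r\<close> in auto)
  have "E \<in> \<int>"
    using korselt_quotient_in_Ints[OF assms] by (simp add: E_def r_def)
  then obtain e :: int where "E = real_of_int e"
    by (elim Ints_cases)
  with \<open>E \<ge> 2\<close> consider "E = 2" | "E \<ge> 3"
    by (cases "e = 2") auto
  then show ?thesis
  proof cases
    case 1
    have "sqrt (8 * real_of_int n + 1) = 4 * x - 1"
      by (rule real_sqrt_unique) (use x in \<open>auto simp: n 1 power2_eq_square algebra_simps\<close>)
    moreover have "\<lceil>sqrt (real_of_int n / 2)\<rceil> = r"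
    proof (rule ceiling_unique)
      \<comment> \<open>Here \<open>n / 2\<close> equals \<open>x\<^sup>2 - x / 2\<close>, which
        exceeds \<open>(x - 1)\<^sup>2\<close> by \<open>3 * x / 2 - 1 > 0\<close>.\<close>
      show "real_of_int r - 1 < sqrt (real_of_int n / 2)"
        unfolding x_def[symmetric]
        by (rule real_less_rsqrt) (use x in \<open>simp add: n 1 power2_eq_square algebra_simps\<close>)
      show "sqrt (real_of_int n / 2) \<le> real_of_int r"
        unfolding x_def[symmetric]
        by (rule real_le_lsqrt) (use x in \<open>auto simp: n 1 power2_eq_square algebra_simps\<close>)
    qed
    ultimately show ?thesis
      using 1 by (simp add: x_def r_def E_def)
  next
    case 2
    have "x * (1 + 3 * (x - 1)) \<le> real_of_int n"
      unfolding n using x 2 by (intro mult_left_mono add_left_mono mult_right_mono) auto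
    \<comment> \<open>Splitting off \<open>2 * x\<^sup>2\<close> leaves a positive surplus; the
      resulting bound \<open>gt\<close> yields both strict inequalities below.\<close>
    moreover have "x * (1 + 3 * (x - 1)) = 2 * x\<^sup>2 + x * (x - 2)"
      by (simp add: power2_eq_square algebra_simps)
    moreover have "x * (x - 2) > 0"
      using x by simp
    ultimately have gt: "2 * x\<^sup>2 < real_of_int n"
      by linarith
    \<comment> \<open>By \<open>gt\<close>, \<open>8 * n + 1\<close> exceeds
      \<open>16 * x\<^sup>2 + 1\<close>, hence also
      \<open>(4 * x - 1)\<^sup>2 = 16 * x\<^sup>2 - 8 * x + 1\<close>.\<close>
    have "4 * x - 1 < sqrt (8 * real_of_int n + 1)"
      by (rule real_less_rsqrt) (use x gt in \<open>simp add: power2_eq_square algebra_simps\<close>)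
    moreover have "x < sqrt (real_of_int n / 2)"
      by (rule real_less_rsqrt) (use gt in simp)
    then have "r < \<lceil>sqrt (real_of_int n / 2)\<rceil>"
      by (simp add: x_def less_ceiling_iff)
    \<comment> \<open>Both bounds are strict and \<open>E\<close> is not 2, so each equivalence
      holds with both sides false.\<close>
    ultimately show ?thesis
      using 2 by (simp add: x_def r_def E_def)
  qed
qed

end
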